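(* Let $k\ge 3$ be an integer, let $\beta>\frac{2(k-1)}{k}$ be a real number, and let $q(n):=\sqrt[k-1]{(k-1)\,\beta^{k-2}\,n^{k-2}}$ for $n\in\mathbb{N}$. Then there exists $N\in\mathbb{N}$ such that for all $n>N$ Breaker has a winning strategy in the Maker-Breaker $C_k$-game with bias $q(n)$ on $K_n$.
   Context: $C_k$ denotes the cycle of length $k$. The Maker-Breaker $C_k$-game with bias $q$ on the complete graph $K_n$ is played as follows. All edges of $K_n$ are initially unclaimed. In each turn first Maker claims exactly one unclaimed edge, then Breaker claims at most $q$ unclaimed edges (at least one, if any is left); for real $q$ this means at most $\lfloor q\rfloor$ edges. The game ends when all edges are claimed. Maker wins if the graph formed by Maker's edges contains a copy of $C_k$ (a not necessarily induced subgraph isomorphic to $C_k$) at the end; otherwise Breaker wins. It is a perfect information game. *)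

theory Defs
  imports Complex_Main "HOL-Library.Ramsey"
begin

text \<open>The complete graph \<open>K\<^sub>n\<close> has vertex set \<open>{..<n}\<close>.\<close>

definition complete_edges :: "nat \<Rightarrow> nat set set" where
  "complete_edges n = nsets {..<n} 2"

definition cycle_edges :: "nat \<Rightarrow> nat set set" where
  "cycle_edges k = {{i, (i + 1) mod k} | i. i < k}"

text \<open>For \<open>k \<ge> 3\<close> every vertex of the cycle lies on an edge, so the embedding \<open>f\<close> automatically
  maps into the vertices covered by \<open>E\<close>.\<close>

definition contains_cycle :: "nat \<Rightarrow> nat set set \<Rightarrow> bool" where
  "contains_cycle k E \<longleftrightarrow> (\<exists>f. inj_on f {..<k} \<and> (\<forall>e\<in>cycle_edges k. f ` e \<in> E))"

text \<open>A history is the list of completed rounds, in chronological order; a round consists of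
  Maker's edge and the set of edges Breaker claims in response.\<close>

type_synonym history = "(nat set \<times> nat set set) list"

definition maker_edges :: "history \<Rightarrow> nat set set" where
  "maker_edges h = fst ` set h"

definition breaker_edges :: "history \<Rightarrow> nat set set" where
  "breaker_edges h = \<Union> (snd ` set h)"

definition unclaimed :: "nat \<Rightarrow> history \<Rightarrow> nat set set" where
  "unclaimed n h = complete_edges n - (maker_edges h \<union> breaker_edges h)"

text \<open>For \<open>q < 1\<close> the two bounds on the size of \<open>B\<close> conflict, and Breaker has no legal reply
  unless no edge is left.\<close>

definition legal_reply :: "nat \<Rightarrow> real \<Rightarrow> history \<Rightarrow> nat set \<Rightarrow> nat set set \<Rightarrow> bool" where
  "legal_reply n q h e B \<longleftrightarrow>
     B \<subseteq> unclaimed n h - {e} \<and> int (card B) \<le> \<lfloor>q\<rfloor> \<and>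
     (unclaimed n h - {e} \<noteq> {} \<longrightarrow> B \<noteq> {})"

inductive legal_play :: "nat \<Rightarrow> real \<Rightarrow> history \<Rightarrow> bool" for n q where
  start: "legal_play n q []"
| round: "legal_play n q h \<Longrightarrow> e \<in> unclaimed n h \<Longrightarrow> legal_reply n q h e B \<Longrightarrow>
    legal_play n q (h @ [(e, B)])"

text \<open>A strategy for Breaker maps the completed rounds and Maker's current edge to a reply.\<close>

type_synonym strategy = "history \<Rightarrow> nat set \<Rightarrow> nat set set"

definition breaker_strategy :: "nat \<Rightarrow> real \<Rightarrow> strategy \<Rightarrow> bool" where
  "breaker_strategy n q \<sigma> \<longleftrightarrow>
     (\<forall>h e. legal_play n q h \<longrightarrow> e \<in> unclaimed n h \<longrightarrow> legal_reply n q h e (\<sigma> h e))"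

definition follows :: "strategy \<Rightarrow> history \<Rightarrow> bool" where
  "follows \<sigma> h \<longleftrightarrow> (\<forall>i<length h. snd (h ! i) = \<sigma> (take i h) (fst (h ! i)))"

text \<open>Every round claims at least one edge, so each play reaches a position without unclaimed
  edges; the winner is determined there.\<close>

definition breaker_has_winning_strategy :: "nat \<Rightarrow> nat \<Rightarrow> real \<Rightarrow> bool" where
  "breaker_has_winning_strategy k n q \<longleftrightarrow>
     (\<exists>\<sigma>. breaker_strategy n q \<sigma> \<and>
        (\<forall>h. legal_play n q h \<longrightarrow> follows \<sigma> h \<longrightarrow> unclaimed n h = {} \<longrightarrow>
           \<not> contains_cycle k (maker_edges h)))"

end

theory Submission
  imports Defs "HOL-Real_Asymp.Real_Asymp"
begin

text \<open>Breaker keeps all Maker degrees below \<open>D \<approx> \<beta> n / q\<close>. Then after each Maker edge \<open>uv\<close> at most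
  \<open>(k - 1) D\<^bsup>k-2\<^esup> \<le> q\<close> edges threaten to close a \<open>C\<^sub>k\<close>; Breaker claims all of them and
  spends the remaining edges on bounding degrees. At most \<open>(k - 2) deg(u) D\<^bsup>k-3\<^esup>\<close> of the threats
  avoid \<open>u\<close>, so Breaker can afford to owe a vertex \<open>q - (k - 2) d D\<^bsup>k-3\<^esup>\<close> edges for its
  \<open>(d+1)\<close>-st Maker edge. Summed up to degree \<open>D\<close> this debt is about \<open>q D k / (2 (k - 1)) > n\<close>, more
  than the vertex has edges, so its Maker degree stays below \<open>D\<close> as long as its danger, the debt
  minus the Breaker degree, is \<open>o(n)\<close>.

  To bound the danger, weigh a vertex by the exponential of its danger, slowly scaled, and let
  Breaker choose the free edges of largest endpoint weight. If these are nearly as heavy as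
  \<open>uv\<close>, the total weight drops. Otherwise Breaker exhausts all heavy edges, and although the total
  weight may grow, the maximal weight \<open>T\<close> of an unclaimed edge drops much more. Hence the total weight
  plus a small multiple of \<open>T\<close> never increases.\<close>

section \<open>Strategies from invariants\<close>

lemma maker_edges_snoc [simp]: "maker_edges (h @ [(e, B)]) = insert e (maker_edges h)"
  by (auto simp: maker_edges_def)

lemma breaker_edges_snoc [simp]: "breaker_edges (h @ [(e, B)]) = breaker_edges h \<union> B"
  by (auto simp: breaker_edges_def)

lemma follows_snoc:
  "follows \<sigma> (h @ [(e, B)]) \<longleftrightarrow> follows \<sigma> h \<and> B = \<sigma> h e"
  unfolding follows_def by (auto simp: nth_append less_Suc_eq)

lemma legal_reply_exists:
  assumes "\<lfloor>q\<rfloor> \<ge> 1"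
  shows "\<exists>B. legal_reply n q h e B"
proof (cases "unclaimed n h - {e} = {}")
  case True
  then show ?thesis using assms by (intro exI[of _ "{}"]) (auto simp: legal_reply_def)
next
  case False
  then obtain x where "x \<in> unclaimed n h - {e}" by blast
  then show ?thesis using assms by (intro exI[of _ "{x}"]) (auto simp: legal_reply_def)
qed

text \<open>A strategy must reply legally after every legal play, also where \<open>I\<close> fails;
  the first premise supplies a reply there. Where \<open>I\<close> holds, a reply preserving it is
  chosen, so \<open>I\<close> persists along every play that follows the strategy.\<close>

lemma winning_strategy_from_invariant:
  assumes q: "\<lfloor>q\<rfloor> \<ge> 1"
    and init: "I []"
    and step: "\<And>h e. I h \<Longrightarrow> e \<in> unclaimed n h \<Longrightarrow>
      \<exists>B. legal_reply n q h e B \<and> I (h @ [(e, B)])"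
    and final: "\<And>h. I h \<Longrightarrow> \<not> contains_cycle k (maker_edges h)"
  shows "breaker_has_winning_strategy k n q"
proof -
  define \<sigma> :: strategy where
    "\<sigma> h e = (SOME B. legal_reply n q h e B \<and> (I h \<longrightarrow> I (h @ [(e, B)])))" for h e
  have \<sigma>: "legal_reply n q h e (\<sigma> h e) \<and> (I h \<longrightarrow> I (h @ [(e, \<sigma> h e)]))"
    if "e \<in> unclaimed n h" for h e
  proof -
    have "\<exists>B. legal_reply n q h e B \<and> (I h \<longrightarrow> I (h @ [(e, B)]))"
      using step[OF _ that] legal_reply_exists[OF q] by blast
    then show ?thesis unfolding \<sigma>_def by (rule someI_ex)
  qed
  have "I h" if "legal_play n q h" "follows \<sigma> h" for h
    using that
  proof induction
    case start
    show ?case by (rule init)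
  next
    case (round h e B)
    then show ?case using \<sigma>[of e h] by (auto simp: follows_snoc)
  qed
  then show ?thesis
    unfolding breaker_has_winning_strategy_def breaker_strategy_def using \<sigma> final by blast
qed

section \<open>Degrees and walks\<close>

definition deg :: "nat set set \<Rightarrow> nat \<Rightarrow> nat" where
  "deg E w = card {e \<in> E. w \<in> e}"

definition neighbours :: "nat set set \<Rightarrow> nat \<Rightarrow> nat set" where
  "neighbours E w = {x. {w, x} \<in> E}"

text \<open>End vertices of walks, not only of paths: repeated vertices can only enlarge the set,
  and its size is only ever bounded from above.\<close>

fun reach :: "nat set set \<Rightarrow> nat \<Rightarrow> nat \<Rightarrow> nat set" where
  "reach E 0 w = {w}"
| "reach E (Suc i) w = (\<Union>x\<in>neighbours E w. reach E i x)"

lemma finite_complete_edges [simp]: "finite (complete_edges n)"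
  unfolding complete_edges_def by (rule finite_imp_finite_nsets) simp

lemma complete_edgesE:
  assumes "e \<in> complete_edges n"
  obtains u v where "e = {u, v}" "u \<noteq> v" "u < n" "v < n"
proof -
  have "card e = 2" "e \<subseteq> {..<n}" using assms by (auto simp: complete_edges_def nsets_def)
  then show ?thesis using that by (auto simp: card_2_iff)
qed

lemma deg_empty [simp]: "deg {} w = 0"
  by (simp add: deg_def)

lemma deg_insert:
  assumes "finite E" "e \<notin> E"
  shows "deg (insert e E) w = deg E w + (if w \<in> e then 1 else 0)"
proof -
  have "{x \<in> insert e E. w \<in> x} = (if w \<in> e then insert e {x \<in> E. w \<in> x} else {x \<in> E. w \<in> x})"
    by auto
  then show ?thesis using assms by (simp add: deg_def)
qed

lemma deg_Un_disjoint:
  assumes "finite E" "finite F" "E \<inter> F = {}"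
  shows "deg (E \<union> F) w = deg E w + deg F w"
proof -
  have "{x \<in> E \<union> F. w \<in> x} = {x \<in> E. w \<in> x} \<union> {x \<in> F. w \<in> x}" by auto
  then show ?thesis using assms by (simp add: deg_def card_Un_disjoint disjoint_iff)
qed

lemma deg_le_card: "finite E \<Longrightarrow> deg E w \<le> card E"
  unfolding deg_def by (intro card_mono) auto

lemma deg_le_order:
  assumes "E \<subseteq> complete_edges n"
  shows "deg E w \<le> n"
proof -
  have "{e \<in> E. w \<in> e} \<subseteq> (\<lambda>x. {w, x}) ` {..<n}"
  proof
    fix e assume "e \<in> {e \<in> E. w \<in> e}"
    then have "w \<in> e" "e \<in> complete_edges n" using assms by auto
    then show "e \<in> (\<lambda>x. {w, x}) ` {..<n}" by (elim complete_edgesE) auto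
  qed
  then have "deg E w \<le> card ((\<lambda>x. {w, x}) ` {..<n})" unfolding deg_def by (intro card_mono) auto
  also have "\<dots> \<le> n" using card_image_le[of "{..<n}" "\<lambda>x. {w, x}"] by simp
  finally show ?thesis .
qed

lemma neighbours_inj: "inj_on (\<lambda>x. {w, x}) A"
  by (auto simp: inj_on_def doubleton_eq_iff)

lemma finite_neighbours: "finite E \<Longrightarrow> finite (neighbours E w)"
  by (rule inj_on_finite[OF neighbours_inj[of w]]) (auto simp: neighbours_def)

lemma card_neighbours_le: "finite E \<Longrightarrow> card (neighbours E w) \<le> deg E w"
  unfolding deg_def by (rule card_inj_on_le[OF neighbours_inj[of w]]) (auto simp: neighbours_def)

lemma finite_reach: "finite E \<Longrightarrow> finite (reach E i w)"
  by (induction i arbitrary: w) (auto simp: finite_neighbours)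

text \<open>The first step is kept apart so that the true degree of the start vertex survives in the
  bound; the count of threats avoiding \<open>u\<close> relies on it.\<close>

lemma card_reach_Suc_le:
  assumes "finite E" "\<And>x. real (card (reach E i x)) \<le> c"
  shows "real (card (reach E (Suc i) w)) \<le> real (deg E w) * c"
proof -
  have c: "0 \<le> c" using assms(2)[of 0] of_nat_0_le_iff[of "card (reach E i 0)"] by linarith
  have "card (reach E (Suc i) w) \<le> (\<Sum>x\<in>neighbours E w. card (reach E i x))"
    using card_UN_le[OF finite_neighbours[OF assms(1)]] by simp
  then have "real (card (reach E (Suc i) w)) \<le> (\<Sum>x\<in>neighbours E w. real (card (reach E i x)))"
    by (simp only: of_nat_sum[symmetric] of_nat_le_iff)
  also have "\<dots> \<le> real (card (neighbours E w)) * c"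
    using sum_bounded_above[of "neighbours E w" "\<lambda>x. real (card (reach E i x))" c] assms(2) by simp
  also have "\<dots> \<le> real (deg E w) * c"
    using card_neighbours_le[OF assms(1)] c by (intro mult_right_mono) auto
  finally show ?thesis .
qed

lemma card_reach_le:
  assumes "finite E" "\<And>x. real (deg E x) \<le> D"
  shows "real (card (reach E i w)) \<le> D ^ i"
proof (induction i arbitrary: w)
  case (Suc i)
  have "0 \<le> D" using assms(2)[of 0] of_nat_0_le_iff[of "deg E 0"] by linarith
  then show ?case
    using card_reach_Suc_le[OF assms(1) Suc.IH, of w] mult_right_mono[OF assms(2)[of w], of "D ^ i"]
    by simp
qed simp

lemma walk_in_reach:
  assumes "\<And>i. i < j \<Longrightarrow> {p i, p (Suc i)} \<in> E"
  shows "p j \<in> reach E j (p 0)"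
  using assms
proof (induction j arbitrary: p)
  case (Suc j)
  have "p (Suc j) \<in> reach E j (p (Suc 0))"
    using Suc.IH[of "\<lambda>i. p (Suc i)"] Suc.prems by simp
  moreover have "p (Suc 0) \<in> neighbours E (p 0)"
    using Suc.prems[of 0] by (simp add: neighbours_def)
  ultimately show ?case by auto
qed simp

section \<open>Edges closing a cycle\<close>

lemma contains_cycle_iff:
  "contains_cycle k E \<longleftrightarrow> (\<exists>f. inj_on f {..<k} \<and> (\<forall>i<k. {f i, f ((i + 1) mod k)} \<in> E))"
proof -
  have "(\<forall>e\<in>cycle_edges k. f ` e \<in> E) \<longleftrightarrow> (\<forall>i<k. {f i, f ((i + 1) mod k)} \<in> E)" for f
  proof -
    have "cycle_edges k = (\<lambda>i. {i, (i + 1) mod k}) ` {..<k}" by (auto simp: cycle_edges_def)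
    then show ?thesis by (simp only: ball_simps) auto
  qed
  then show ?thesis by (simp add: contains_cycle_def)
qed

lemma shift_mod_inj:
  fixes i j c k :: nat
  assumes "(i + c) mod k = (j + c) mod k" "i < k" "j < k"
  shows "i = j"
proof -
  have "a = b" if "(a + c) mod k = (b + c) mod k" "a < k" "a \<ge> b" for a b
  proof -
    have "k dvd (a + c) - (b + c)" using that by (subst mod_eq_dvd_iff_nat[symmetric]) auto
    then have "k dvd a - b" by simp
    then have "a - b = 0" using dvd_imp_le[of k "a - b"] that(2) by (cases "a - b = 0") simp_all
    then show ?thesis using that(3) by simp
  qed
  from this[of i j] this[of j i] show ?thesis using assms by (cases "i \<le> j") auto
qed

text \<open>The embedding must use \<open>e\<close>, as \<open>E\<close> alone has no such cycle.
  Rotating the indices makes \<open>e\<close> the edge from the last vertex back to the first, so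
  the rest is a path indexed without \<open>mod\<close>.\<close>

lemma contains_cycle_rotate:
  assumes "contains_cycle k (insert e E)" "\<not> contains_cycle k E"
  obtains g where "inj_on g {..<k}" "\<forall>i<k. {g i, g ((i + 1) mod k)} \<in> insert e E"
    "{g (k - 1), g 0} = e"
proof -
  obtain f where f: "inj_on f {..<k}" "\<forall>i<k. {f i, f ((i + 1) mod k)} \<in> insert e E"
    using assms(1) by (auto simp: contains_cycle_iff)
  have "\<exists>a<k. {f a, f ((a + 1) mod k)} \<notin> E"
    using assms(2) f(1) unfolding contains_cycle_iff by blast
  then obtain a where a: "a < k" "{f a, f ((a + 1) mod k)} = e" using f(2) by blast
  \<comment> \<open>The shift by \<open>a + 1\<close> sends index \<open>k - 1\<close> to
    \<open>a\<close> and index \<open>0\<close> to the successor of \<open>a\<close>.\<close>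
  define g where "g i = f ((i + (a + 1)) mod k)" for i
  show ?thesis
  proof
    show "inj_on g {..<k}"
    proof (rule inj_onI)
      fix i j assume ij: "i \<in> {..<k}" "j \<in> {..<k}" "g i = g j"
      then have "(i + (a + 1)) mod k = (j + (a + 1)) mod k"
        using f(1) a(1) by (auto simp: g_def inj_on_def)
      then show "i = j" by (rule shift_mod_inj) (use ij in auto)
    qed
    show "\<forall>i<k. {g i, g ((i + 1) mod k)} \<in> insert e E"
    proof (intro allI impI)
      fix i assume "i < k"
      have "g ((i + 1) mod k) = f (((i + (a + 1)) mod k + 1) mod k)"
        unfolding g_def by (simp only: mod_add_left_eq) (simp add: add_ac)
      moreover have "(i + (a + 1)) mod k < k" using a(1) by simp
      ultimately show "{g i, g ((i + 1) mod k)} \<in> insert e E" using f(2) unfolding g_def by metis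
    qed
    have "k - 1 + (a + 1) = a + k" using a(1) by simp
    then have "g (k - 1) = f a" using a(1) by (simp only: g_def) simp
    moreover have "g 0 = f ((a + 1) mod k)" by (simp add: g_def)
    ultimately show "{g (k - 1), g 0} = e" using a(2) by simp
  qed
qed

text \<open>Removing \<open>e'\<close> from the new cycle leaves a path with \<open>k - 1\<close>
  edges. It runs through \<open>{u, v}\<close>, since otherwise \<open>e'\<close> would close a
  cycle with \<open>E\<close> alone; removing \<open>{u, v}\<close> as well leaves two walks in
  \<open>E\<close> with \<open>k - 2\<close> edges altogether.\<close>

lemma closing_edge_in_reach:
  assumes k: "k \<ge> 3"
    and cyc: "contains_cycle k (insert e' (insert {u, v} E))"
    and no: "\<not> contains_cycle k (insert {u, v} E)" "\<not> contains_cycle k (insert e' E)"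
  obtains x y i where "e' = {x, y}" "i \<le> k - 2" "x \<in> reach E i u" "y \<in> reach E (k - 2 - i) v"
proof -
  obtain g where g: "inj_on g {..<k}"
    "\<forall>i<k. {g i, g ((i + 1) mod k)} \<in> insert e' (insert {u, v} E)" "{g (k - 1), g 0} = e'"
    using contains_cycle_rotate[OF cyc no(1)] .
  have eq: "i = j" if "i < k" "j < k" "g i = g j" for i j
    using g(1) that by (auto simp: inj_on_def)
  have path: "{g i, g (Suc i)} \<in> insert {u, v} E" if "i < k - 1" for i
  proof -
    \<comment> \<open>By injectivity a path edge can equal the closing edge only if
      \<open>i = 0\<close> and \<open>k = 2\<close>.\<close>
    have "{g i, g (Suc i)} \<noteq> {g (k - 1), g 0}"
    proof
      assume "{g i, g (Suc i)} = {g (k - 1), g 0}"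
      then have "g i = g (k - 1) \<or> g i = g 0 \<and> g (Suc i) = g (k - 1)"
        by (auto simp: doubleton_eq_iff)
      moreover have "i < k" "k - 1 < k" "0 < k" "Suc i < k" using that k by auto
      ultimately have "i = k - 1 \<or> i = 0 \<and> Suc i = k - 1" using eq by blast
      then show False using that k by linarith
    qed
    then show ?thesis using g(2)[rule_format, of i] g(3) that by auto
  qed
  have "\<exists>b<k - 1. {g b, g (Suc b)} = {u, v}"
  proof (rule ccontr)
    assume neg: "\<not> ?thesis"
    have "{g i, g ((i + 1) mod k)} \<in> insert e' E" if "i < k" for i
    proof (cases "i = k - 1")
      case True
      then show ?thesis using g(3) that by auto
    next
      case False
      then have "i < k - 1" using that by simp
      then show ?thesis using path[of i] neg that by auto
    qed
    then show False using no(2) g(1) by (auto simp: contains_cycle_iff)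
  qed
  then obtain b where b: "b < k - 1" "{g b, g (Suc b)} = {u, v}" by blast
  have inE: "{g i, g (Suc i)} \<in> E" if "i < k - 1" "i \<noteq> b" for i
  proof -
    have "{g i, g (Suc i)} \<noteq> {g b, g (Suc b)}"
    proof
      assume "{g i, g (Suc i)} = {g b, g (Suc b)}"
      then have "g i = g b \<or> g i = g (Suc b) \<and> g (Suc i) = g b"
        by (auto simp: doubleton_eq_iff)
      moreover have "i < k" "b < k" "Suc i < k" "Suc b < k" using that b(1) by auto
      ultimately have "i = b \<or> i = Suc b \<and> Suc i = b" using eq by blast
      then show False using that(2) by linarith
    qed
    then show ?thesis using path[OF that(1)] b(2) by auto
  qed
  \<comment> \<open>The first part of the path is read backwards, from \<open>g b\<close> to
    \<open>g 0\<close>; the form of the statement matches \<open>p i = g (b - i)\<close> in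
    \<open>walk_in_reach\<close>.\<close>
  have "g (b - b) \<in> reach E b (g (b - 0))"
  proof (rule walk_in_reach)
    fix i assume "i < b"
    then have "{g (b - Suc i), g (Suc (b - Suc i))} \<in> E" using b(1) by (intro inE) auto
    then show "{g (b - i), g (b - Suc i)} \<in> E" using \<open>i < b\<close> by (simp add: Suc_diff_Suc insert_commute)
  qed
  then have r0: "g 0 \<in> reach E b (g b)" by simp
  have "g (Suc b + (k - 2 - b)) \<in> reach E (k - 2 - b) (g (Suc b + 0))"
    by (rule walk_in_reach) (use b(1) inE in auto)
  moreover have "Suc b + (k - 2 - b) = k - 1" using b(1) by simp
  ultimately have r1: "g (k - 1) \<in> reach E (k - 2 - b) (g (Suc b))" by (simp only: add_0_right)
  consider "g b = u" "g (Suc b) = v" | "g b = v" "g (Suc b) = u"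
    using b(2) by (auto simp: doubleton_eq_iff)
  then show ?thesis
  proof cases
    case 1
    show ?thesis by (rule that[of "g 0" "g (k - 1)" b]) (use 1 r0 r1 b g(3) in auto)
  next
    case 2
    \<comment> \<open>The path meets \<open>v\<close> before \<open>u\<close>, so the walk from
      \<open>u\<close> is the second one, of length \<open>k - 2 - b\<close>.\<close>
    have "k - 2 - (k - 2 - b) = b" using b(1) by simp
    then show ?thesis
      by (intro that[of "g (k - 1)" "g 0" "k - 2 - b"]) (use 2 r0 r1 b g(3) in auto)
  qed
qed

section \<open>Counting the threats created by one Maker edge\<close>

definition closing :: "nat \<Rightarrow> nat set \<Rightarrow> nat set set \<Rightarrow> nat set set \<Rightarrow> nat set set" where
  "closing k e E U = {e' \<in> U. contains_cycle k (insert e' (insert e E))}"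

lemma real_card_UN_le:
  assumes "finite I" "\<And>i. i \<in> I \<Longrightarrow> real (card (A i)) \<le> c"
  shows "real (card (\<Union>i\<in>I. A i)) \<le> real (card I) * c"
proof -
  have "real (card (\<Union>i\<in>I. A i)) \<le> (\<Sum>i\<in>I. real (card (A i)))"
    using card_UN_le[OF assms(1), of A] by (simp only: of_nat_sum[symmetric] of_nat_le_iff)
  also have "\<dots> \<le> real (card I) * c"
    using sum_bounded_above[of I "\<lambda>i. real (card (A i))" c] assms(2) by simp
  finally show ?thesis .
qed

lemma card_pairs_le:
  assumes "finite X" "finite Y" "real (card X) \<le> a" "real (card Y) \<le> b"
  shows "real (card ((\<lambda>(x, y). {x, y}) ` (X \<times> Y))) \<le> a * b"
proof -
  have "real (card ((\<lambda>(x, y). {x, y}) ` (X \<times> Y))) \<le> real (card X) * real (card Y)"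
    using card_image_le[of "X \<times> Y" "\<lambda>(x, y). {x, y}"] assms(1,2)
    by (simp add: card_cartesian_product flip: of_nat_mult)
  also have "\<dots> \<le> a * b"
    using assms(3,4) of_nat_0_le_iff[of "card X"] by (intro mult_mono) linarith+
  finally show ?thesis .
qed

context
  fixes k :: nat and E U :: "nat set set" and D :: real and u v :: nat
  assumes k: "k \<ge> 3" and fin: "finite E" and degD: "\<And>x. real (deg E x) \<le> D"
    and no1: "\<not> contains_cycle k (insert {u, v} E)"
    and no2: "\<And>e'. e' \<in> U \<Longrightarrow> \<not> contains_cycle k (insert e' E)"
begin

private abbreviation "ends i \<equiv> (\<lambda>(x, y). {x, y}) ` (reach E i u \<times> reach E (k - 2 - i) v)"

private lemma closing_endsE:
  assumes "e' \<in> closing k {u, v} E U"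
  obtains i where "i \<le> k - 2" "e' \<in> ends i"
proof -
  have "e' \<in> U" and c: "contains_cycle k (insert e' (insert {u, v} E))"
    using assms by (auto simp: closing_def)
  obtain x y i where "e' = {x, y}" "i \<le> k - 2" "x \<in> reach E i u" "y \<in> reach E (k - 2 - i) v"
    using closing_edge_in_reach[OF k c no1 no2[OF \<open>e' \<in> U\<close>]] .
  then show ?thesis by (intro that[of i]) auto
qed

text \<open>There are \<open>k - 1\<close> ways to split \<open>k - 2\<close> into the lengths of
  the two walks, and each split allows at most \<open>D ^ (k - 2)\<close> pairs of end
  vertices.\<close>

lemma card_closing_le: "real (card (closing k {u, v} E U)) \<le> (real k - 1) * D ^ (k - 2)"
proof -
  have "closing k {u, v} E U \<subseteq> (\<Union>i\<in>{..k - 2}. ends i)"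
  proof
    fix e' assume "e' \<in> closing k {u, v} E U"
    then obtain i where "i \<le> k - 2" "e' \<in> ends i" by (rule closing_endsE)
    then show "e' \<in> (\<Union>i\<in>{..k - 2}. ends i)" by (intro UN_I[of i]) auto
  qed
  then have "real (card (closing k {u, v} E U)) \<le> real (card (\<Union>i\<in>{..k - 2}. ends i))"
    using finite_reach[OF fin] by (intro of_nat_mono card_mono) auto
  also have "\<dots> \<le> real (card {..k - 2}) * D ^ (k - 2)"
  proof (rule real_card_UN_le)
    fix i assume i: "i \<in> {..k - 2}"
    have "real (card (ends i)) \<le> D ^ i * D ^ (k - 2 - i)"
      by (intro card_pairs_le finite_reach card_reach_le fin degD)
    also have "\<dots> = D ^ (k - 2)"
      using i by (simp only: power_add[symmetric] atMost_iff le_add_diff_inverse)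
    finally show "real (card (ends i)) \<le> D ^ (k - 2)" .
  qed simp
  also have "real (card {..k - 2}) = real k - 1" using k by simp
  finally show ?thesis .
qed

text \<open>A walk of length 0 from \<open>u\<close> ends at \<open>u\<close>, so an edge avoiding
  \<open>u\<close> comes from one of only \<open>k - 2\<close> splits. Its walk from
  \<open>u\<close> starts with one of at most \<open>deg E u\<close> steps, and the other
  \<open>k - 3\<close> steps have at most \<open>D\<close> choices each.\<close>

lemma card_closing_avoiding_le:
  "real (card {e' \<in> closing k {u, v} E U. u \<notin> e'}) \<le> (real k - 2) * real (deg E u) * D ^ (k - 3)"
proof -
  have "{e' \<in> closing k {u, v} E U. u \<notin> e'} \<subseteq> (\<Union>i\<in>{1..k - 2}. ends i)"
  proof
    fix e' assume e': "e' \<in> {e' \<in> closing k {u, v} E U. u \<notin> e'}"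
    then have "e' \<in> closing k {u, v} E U" by simp
    then obtain i where i: "i \<le> k - 2" "e' \<in> ends i" by (rule closing_endsE)
    with e' have "i \<noteq> 0" by (cases i) auto
    then show "e' \<in> (\<Union>i\<in>{1..k - 2}. ends i)" using i by (intro UN_I[of i]) auto
  qed
  then have "real (card {e' \<in> closing k {u, v} E U. u \<notin> e'})
      \<le> real (card (\<Union>i\<in>{1..k - 2}. ends i))"
    using finite_reach[OF fin] by (intro of_nat_mono card_mono) auto
  also have "\<dots> \<le> real (card {1..k - 2}) * (real (deg E u) * D ^ (k - 3))"
  proof (rule real_card_UN_le)
    fix i assume i: "i \<in> {1..k - 2}"
    then obtain j where j: "i = Suc j" by (cases i) auto
    have "real (card (ends i)) \<le> (real (deg E u) * D ^ j) * D ^ (k - 2 - i)"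
      unfolding j
      by (intro card_pairs_le finite_reach card_reach_le card_reach_Suc_le fin degD)
    also have "\<dots> = real (deg E u) * D ^ (j + (k - 2 - i))"
      by (simp add: power_add)
    also have "j + (k - 2 - i) = k - 3" using i j by auto
    finally show "real (card (ends i)) \<le> real (deg E u) * D ^ (k - 3)" .
  qed simp
  also have "real (card {1..k - 2}) = real k - 2" using k by simp
  finally show ?thesis by (simp add: mult.assoc)
qed

end

section \<open>The potential\<close>

lemma exp_le_quadratic:
  fixes t :: real
  assumes "t \<le> 1"
  shows "exp t \<le> 1 + t + t\<^sup>2"
proof (cases "0 \<le> t")
  case True
  then show ?thesis using assms by (rule exp_bound)
next
  case False
  define s where "s = - t"
  have s: "0 < s" using False by (simp add: s_def)
  have "1 + s \<le> exp s" by (rule exp_ge_add_one_self)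
  then have "exp (- s) \<le> 1 / (1 + s)"
    using s by (simp add: exp_minus field_simps)
  \<comment> \<open>The product equals \<open>1 + s ^ 3\<close>.\<close>
  also have "1 \<le> (1 - s + s\<^sup>2) * (1 + s)"
    using s by (simp add: algebra_simps power2_eq_square)
  then have "1 / (1 + s) \<le> 1 - s + s\<^sup>2" using s by (simp add: field_simps)
  finally show ?thesis by (simp add: s_def)
qed

text \<open>Double counting of the incidences between vertices and edges.\<close>

lemma sum_deg_eq:
  fixes \<phi> :: "nat \<Rightarrow> real"
  assumes "finite B" "finite V" "\<And>e. e \<in> B \<Longrightarrow> e \<subseteq> V"
  shows "(\<Sum>w\<in>V. real (deg B w) * \<phi> w) = (\<Sum>e\<in>B. \<Sum>w\<in>e. \<phi> w)"
proof -
  have "(\<Sum>w\<in>V. real (deg B w) * \<phi> w) = (\<Sum>w\<in>V. \<Sum>e | e \<in> B \<and> w \<in> e. \<phi> w)"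
    by (simp add: deg_def)
  also have "\<dots> = (\<Sum>e\<in>B. \<Sum>w | w \<in> V \<and> w \<in> e. \<phi> w)"
    by (rule sum.swap_restrict[OF assms(2,1)])
  also have "\<dots> = (\<Sum>e\<in>B. \<Sum>w\<in>e. \<phi> w)"
    using assms(3) by (intro sum.cong) auto
  finally show ?thesis .
qed

text \<open>One round multiplies each weight by an exponential, which is expanded to second order.
  An error term remains only at \<open>u\<close> and \<open>v\<close>: elsewhere the exponent is
  \<open>- b\<close> with \<open>0 \<le> b \<le> \<mu>\<close>, and
  \<open>b\<^sup>2 \<le> \<mu> * b\<close> is absorbed by the factor
  \<open>1 - \<mu>\<close>.\<close>

lemma potential_change:
  fixes \<phi> g :: "nat \<Rightarrow> real" and rate \<mu> Q :: real
  assumes fin: "finite V" "finite B" and uv: "u \<in> V" "v \<in> V" "u \<noteq> v"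
    and B: "\<And>e. e \<in> B \<Longrightarrow> e \<subseteq> V" "real (card B) \<le> Q"
    and \<phi>: "\<And>w. 0 \<le> \<phi> w" and rate: "0 \<le> rate" "rate * Q = \<mu>" "\<mu> \<le> 1"
    and g: "\<bar>g u\<bar> \<le> Q" "\<bar>g v\<bar> \<le> Q"
  shows "(\<Sum>w\<in>V. \<phi> w * exp (rate * ((if w \<in> {u, v} then g w else 0) - real (deg B w))))
    \<le> (\<Sum>w\<in>V. \<phi> w) + rate * (g u * \<phi> u + g v * \<phi> v)
       - (1 - \<mu>) * rate * (\<Sum>e\<in>B. \<Sum>w\<in>e. \<phi> w) + 4 * \<mu>\<^sup>2 * (\<phi> u + \<phi> v)"
proof -
  have dQ: "real (deg B w) \<le> Q" for w using deg_le_card[OF fin(2), of w] B(2) by linarith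
  have \<mu>0: "0 \<le> \<mu>" using dQ[of 0] rate by (smt (verit) mult_nonneg_nonneg of_nat_0_le_iff)
  let ?i = "\<lambda>w. if w \<in> {u, v} then rate * (g w * \<phi> w) + 4 * \<mu>\<^sup>2 * \<phi> w else 0"
  have "\<phi> w * exp (rate * ((if w \<in> {u, v} then g w else 0) - real (deg B w)))
    \<le> \<phi> w + ?i w - (1 - \<mu>) * rate * (real (deg B w) * \<phi> w)" for w
  proof -
    define b where "b = rate * real (deg B w)"
    have b: "0 \<le> b" "b \<le> \<mu>" using rate mult_left_mono[OF dQ rate(1), of w] by (auto simp: b_def)
    show ?thesis
    proof (cases "w \<in> {u, v}")
      case True
      have gw: "\<bar>rate * g w\<bar> \<le> \<mu>"
        using True g mult_left_mono[of "\<bar>g w\<bar>" Q rate] rate by (auto simp: abs_mult)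
      define t where "t = rate * g w - b"
      \<comment> \<open>Gain and Breaker degree contribute at most \<open>\<mu>\<close> each, whence
        the 4 in the error term.\<close>
      have t: "\<bar>t\<bar> \<le> 2 * \<mu>" "t \<le> 1" using gw b rate(3) by (auto simp: t_def)
      have "t\<^sup>2 \<le> (2 * \<mu>)\<^sup>2" using t(1) by (metis abs_le_square_iff abs_of_nonneg abs_ge_zero order_trans)
      then have "exp t \<le> 1 + t + 4 * \<mu>\<^sup>2" using exp_le_quadratic[OF t(2)] by (simp add: power_mult_distrib)
      also have "\<dots> \<le> 1 + rate * g w + 4 * \<mu>\<^sup>2 - (1 - \<mu>) * b"
        using b \<mu>0 by (simp add: t_def algebra_simps)
      finally have "\<phi> w * exp t \<le> \<phi> w * (1 + rate * g w + 4 * \<mu>\<^sup>2 - (1 - \<mu>) * b)"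
        using \<phi> by (rule mult_left_mono)
      then show ?thesis using True by (simp add: t_def b_def algebra_simps)
    next
      case False
      have "exp (- b) \<le> 1 - b + b\<^sup>2" using exp_le_quadratic[of "- b"] b by simp
      also have "\<dots> \<le> 1 - (1 - \<mu>) * b"
        using b mult_right_mono[OF b(2) b(1)] by (simp add: algebra_simps power2_eq_square)
      finally have "\<phi> w * exp (- b) \<le> \<phi> w * (1 - (1 - \<mu>) * b)"
        using \<phi> by (rule mult_left_mono)
      then show ?thesis using False by (simp add: b_def algebra_simps)
    qed
  qed
  then have "(\<Sum>w\<in>V. \<phi> w * exp (rate * ((if w \<in> {u, v} then g w else 0) - real (deg B w))))
    \<le> (\<Sum>w\<in>V. \<phi> w + ?i w - (1 - \<mu>) * rate * (real (deg B w) * \<phi> w))"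
    by (intro sum_mono)
  also have "\<dots> = (\<Sum>w\<in>V. \<phi> w) + (\<Sum>w\<in>V. ?i w) - (1 - \<mu>) * rate * (\<Sum>w\<in>V. real (deg B w) * \<phi> w)"
    by (simp only: sum.distrib sum_subtractf sum_distrib_left)
  also have "(\<Sum>w\<in>V. ?i w) = (\<Sum>w\<in>{u, v}. rate * (g w * \<phi> w) + 4 * \<mu>\<^sup>2 * \<phi> w)"
    using fin(1) uv by (intro sum.mono_neutral_cong_right) auto
  also have "\<dots> = rate * (g u * \<phi> u + g v * \<phi> v) + 4 * \<mu>\<^sup>2 * (\<phi> u + \<phi> v)"
    using uv(3) by (simp add: algebra_simps)
  also have "(\<Sum>w\<in>V. real (deg B w) * \<phi> w) = (\<Sum>e\<in>B. \<Sum>w\<in>e. \<phi> w)"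
    by (rule sum_deg_eq[OF fin(2,1) B(1)])
  finally show ?thesis by simp
qed

text \<open>\<open>C\<close> stands for the threats and \<open>H\<close> for the heavy edges. If
  they number at least \<open>Q\<close> together, \<open>C\<close> is filled up with heavy edges to
  size \<open>Q\<close>; otherwise both are taken completely, with one arbitrary edge of
  \<open>U\<close> added because Breaker must not pass.\<close>

lemma edge_set_choice:
  assumes "finite U" "C \<subseteq> U" "H \<subseteq> U" "C \<inter> H = {}" "card C \<le> Q" "0 < Q"
  obtains B where "B \<subseteq> U" "C \<subseteq> B" "card B \<le> Q" "U \<noteq> {} \<longrightarrow> B \<noteq> {}"
    "H \<subseteq> B \<or> card B = Q \<and> B - C \<subseteq> H"
proof -
  have fin: "finite C" "finite H" using assms finite_subset by blast+
  show ?thesis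
  proof (cases "Q \<le> card C + card H")
    case True
    then have "Q - card C \<le> card H" by simp
    then obtain G where G: "G \<subseteq> H" "card G = Q - card C" by (rule obtain_subset_with_card_n)
    then have "card (C \<union> G) = card C + card G"
      using fin assms(4) finite_subset by (intro card_Un_disjoint) blast+
    then have "card (C \<union> G) = Q" using G assms(5) by simp
    moreover from this have "C \<union> G \<noteq> {}" using assms(6) by auto
    ultimately show ?thesis using G assms by (intro that[of "C \<union> G"]) auto
  next
    case False
    have card: "card (C \<union> H) < Q" using card_Un_le[of C H] False by simp
    show ?thesis
    proof (cases "U = {}")
      case True
      then show ?thesis using assms by (intro that[of "{}"]) auto
    next
      case False
      then obtain x where "x \<in> U" by blast
      moreover have "card (insert x (C \<union> H)) \<le> Q"
        using card card_insert_le_m1[of Q "C \<union> H" x] assms(6) by simp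
      ultimately show ?thesis using assms by (intro that[of "insert x (C \<union> H)"]) auto
    qed
  qed
qed

section \<open>Breaker's reply\<close>

text \<open>\<open>closing_bound\<close> lets Breaker answer all threats of a round. By
  \<open>degree_bound\<close>, the debt at degree \<open>D - 1\<close> would exceed
  \<open>n\<close>, a cap on the Breaker degree, plus the largest danger that the potential
  permits.\<close>

locale cycle_game =
  fixes k n Q :: nat and D \<delta> \<mu> :: real
  assumes k: "k \<ge> 3" and n: "0 < n" and Q: "0 < Q" and D: "1 \<le> D"
    and \<delta>: "0 < \<delta>" "\<delta> \<le> 1" and \<mu>_def: "\<mu> = \<delta>\<^sup>2 / 200"
    and closing_bound: "(real k - 1) * D ^ (k - 2) \<le> real Q"
    and degree_bound: "real n + real Q * ln (2 * real n) / \<mu>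
      < (D - 1) * real Q * (real k / (2 * (real k - 1)) - \<delta>)"
begin

text \<open>\<open>gain d\<close> is the debt for the \<open>(d+1)\<close>-st Maker edge at a vertex, reduced by the slack \<open>\<delta> Q\<close>.\<close>

definition gain :: "nat \<Rightarrow> real" where
  "gain d = (1 - \<delta>) * real Q - (real k - 2) * D ^ (k - 3) * real d"

text \<open>Closed form of the sum of \<open>gain j\<close> over \<open>j < d\<close>, the total
  debt after \<open>d\<close> Maker edges.\<close>

definition required :: "nat \<Rightarrow> real" where
  "required d = (1 - \<delta>) * real Q * real d - (real k - 2) * D ^ (k - 3) * (real d * (real d - 1) / 2)"

definition danger :: "nat set set \<Rightarrow> nat set set \<Rightarrow> nat \<Rightarrow> real" where
  "danger M K w = required (deg M w) - real (deg K w)"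

definition weight :: "nat set set \<Rightarrow> nat set set \<Rightarrow> nat \<Rightarrow> real" where
  "weight M K w = exp (\<mu> / real Q * danger M K w)"

definition edge_weight :: "nat set set \<Rightarrow> nat set set \<Rightarrow> nat set \<Rightarrow> real" where
  "edge_weight M K e = (\<Sum>w\<in>e. weight M K w)"

definition free :: "nat set set \<Rightarrow> nat set set \<Rightarrow> nat set set" where
  "free M K = complete_edges n - (M \<union> K)"

definition controlled :: "nat set set \<Rightarrow> nat set set \<Rightarrow> bool" where
  "controlled M K \<longleftrightarrow> (\<exists>T\<ge>0. (\<forall>e\<in>free M K. edge_weight M K e \<le> T) \<and>
     (\<Sum>w<n. weight M K w) + \<delta> / 4 * T \<le> 2 * real n)"

text \<open>Describes positions before a Maker move. The degree clause allows \<open>D\<close>, but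
  the weight bound improves it to \<open>D - 1\<close>, so that it survives the next Maker
  edge.\<close>

definition safe :: "nat set set \<Rightarrow> nat set set \<Rightarrow> bool" where
  "safe M K \<longleftrightarrow> M \<subseteq> complete_edges n \<and> K \<subseteq> complete_edges n \<and> (\<forall>w. real (deg M w) \<le> D) \<and>
     \<not> contains_cycle k M \<and> (\<forall>e\<in>free M K. \<not> contains_cycle k (insert e M)) \<and> controlled M K"

section \<open>Bounds on debts, degrees and weights\<close>

lemma \<mu>_bounds: "0 < \<mu>" "\<mu> \<le> \<delta> / 200" "\<mu> \<le> 1 / 200"
proof -
  have "\<delta>\<^sup>2 \<le> \<delta>" "0 < \<delta>\<^sup>2" using \<delta> by (auto simp: power2_eq_square mult_left_le_one_le)
  then show "0 < \<mu>" "\<mu> \<le> \<delta> / 200" "\<mu> \<le> 1 / 200" using \<delta>(2) unfolding \<mu>_def by linarith+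
qed

lemma required_Suc: "required (Suc d) = required d + gain d"
  by (simp add: required_def gain_def field_simps)

lemma weight_pos: "0 < weight M K w"
  by (simp add: weight_def)

lemma weight_nonneg: "0 \<le> weight M K w"
  by (simp add: weight_def)

lemma D_power: "D * D ^ (k - 3) = D ^ (k - 2)"
proof -
  have "k - 2 = Suc (k - 3)" using k by simp
  then show ?thesis by simp
qed

lemma avoiding_bound:
  assumes "x \<le> D"
  shows "(real k - 2) * D ^ (k - 3) * x \<le> (real k - 2) / (real k - 1) * real Q"
proof -
  have "(real k - 2) * D ^ (k - 3) * x \<le> (real k - 2) * D ^ (k - 3) * D"
    using assms k D by (intro mult_left_mono) auto
  also have "\<dots> = (real k - 2) * D ^ (k - 2)" using D_power by (simp add: mult.commute)
  also have "\<dots> \<le> (real k - 2) * (real Q / (real k - 1))"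
    using closing_bound k by (intro mult_left_mono) (auto simp: field_simps)
  finally show ?thesis by (simp add: field_simps)
qed

text \<open>\<open>gain d + \<delta> * Q\<close> is \<open>Q\<close> minus the bound on threats
  avoiding a vertex of degree \<open>d\<close>: the part of a full reply that can be credited to
  this vertex.\<close>

lemma gain_bounds:
  assumes "real d \<le> D"
  shows "0 \<le> gain d + \<delta> * real Q" "gain d + \<delta> * real Q \<le> real Q" "\<bar>gain d\<bar> \<le> real Q"
proof -
  have eq: "gain d + \<delta> * real Q = real Q - (real k - 2) * D ^ (k - 3) * real d"
    by (simp add: gain_def algebra_simps)
  have "(real k - 2) / (real k - 1) * real Q \<le> 1 * real Q"
    using k by (intro mult_right_mono) (auto simp: field_simps)
  then show 1: "0 \<le> gain d + \<delta> * real Q" using avoiding_bound[OF assms] eq by linarith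
  have "0 \<le> (real k - 2) * D ^ (k - 3) * real d" using k D by (intro mult_nonneg_nonneg) auto
  then show 2: "gain d + \<delta> * real Q \<le> real Q" using eq by linarith
  have "0 \<le> \<delta> * real Q" "\<delta> * real Q \<le> real Q"
    using \<delta> by (auto simp: mult_left_le_one_le)
  then show "\<bar>gain d\<bar> \<le> real Q" using 1 2 by linarith
qed

text \<open>Bounding \<open>D ^ (k - 3) * (d - 1)\<close> by \<open>Q / (k - 1)\<close> makes the
  quadratic debt linear. The half from summing over the degrees leaves the coefficient
  \<open>k / (2 * (k - 1))\<close>, the reciprocal of the threshold for
  \<open>\<beta>\<close>.\<close>

lemma required_ge:
  assumes "real d \<le> D"
  shows "real d * real Q * (real k / (2 * (real k - 1)) - \<delta>) \<le> required d"
proof -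
  have bound: "(real k - 2) * D ^ (k - 3) * (real d - 1) \<le> (real k - 2) / (real k - 1) * real Q"
    using assms by (intro avoiding_bound) simp
  have "real d * ((1 - \<delta>) * real Q - (real k - 2) / (real k - 1) * real Q / 2)
    \<le> real d * ((1 - \<delta>) * real Q - (real k - 2) * D ^ (k - 3) * (real d - 1) / 2)"
    by (intro mult_left_mono diff_left_mono divide_right_mono bound) auto
  also have "\<dots> = required d" by (simp add: required_def field_simps)
  also have "real d * ((1 - \<delta>) * real Q - (real k - 2) / (real k - 1) * real Q / 2)
    = real d * real Q * (1 - (real k - 2) / (2 * (real k - 1)) - \<delta>)" by (simp add: algebra_simps)
  also have "1 - (real k - 2) / (2 * (real k - 1)) = real k / (2 * (real k - 1))"
    using k by (simp add: field_simps)
  finally show ?thesis .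
qed

text \<open>A single weight is at most the total, hence at most \<open>2 * n\<close>, which bounds
  the danger by \<open>Q * ln (2 * n) / \<mu>\<close>. As the Breaker degree is at most
  \<open>n\<close>, this limits the debt, and \<open>degree_bound\<close> turns that into a limit on
  the degree.\<close>

lemma deg_le_of_safe:
  assumes "safe M K"
  shows "real (deg M w) \<le> D - 1"
proof (cases "w < n")
  case False
  have empty: "{e \<in> M. w \<in> e} = {}"
    using assms False by (auto simp: safe_def complete_edges_def nsets_def)
  show ?thesis unfolding deg_def empty using D by simp
next
  case True
  obtain T where T: "T \<ge> 0" "(\<Sum>w<n. weight M K w) + \<delta> / 4 * T \<le> 2 * real n"
    using assms by (auto simp: safe_def controlled_def)
  have "weight M K w \<le> (\<Sum>w<n. weight M K w)"
    using True weight_nonneg by (intro member_le_sum) auto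
  also have "\<dots> \<le> 2 * real n" using T \<delta> by (smt (verit) mult_nonneg_nonneg divide_nonneg_pos)
  finally have "\<mu> / real Q * danger M K w \<le> ln (2 * real n)"
    using n by (simp add: weight_def ln_ge_iff)
  then have "danger M K w \<le> real Q * ln (2 * real n) / \<mu>"
    using Q \<mu>_bounds by (simp add: field_simps)
  moreover have "real (deg K w) \<le> real n"
    using assms deg_le_order by (auto simp: safe_def)
  ultimately have req: "required (deg M w) \<le> real n + real Q * ln (2 * real n) / \<mu>"
    by (simp add: danger_def)
  define \<alpha> where "\<alpha> = real k / (2 * (real k - 1)) - \<delta>"
  have deg: "real (deg M w) \<le> D" using assms by (simp add: safe_def)
  have "0 \<le> real n + real Q * ln (2 * real n) / \<mu>"
    using n \<mu>_bounds by (intro add_nonneg_nonneg divide_nonneg_pos mult_nonneg_nonneg) auto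
  then have "0 < (D - 1) * real Q * \<alpha>" using degree_bound by (simp add: \<alpha>_def)
  moreover have "0 \<le> (D - 1) * real Q" using D by simp
  ultimately have \<alpha>: "0 < \<alpha>" by (smt (verit) mult_nonneg_nonpos)
  have "real (deg M w) * real Q * \<alpha> < (D - 1) * real Q * \<alpha>"
    using required_ge[OF deg] req degree_bound by (simp add: \<alpha>_def)
  then show ?thesis using \<alpha> Q by simp
qed

lemma finite_free [simp]: "finite (free M K)"
  by (simp add: free_def)

lemma weight_update:
  assumes "finite M" "finite K" "finite B" "e \<notin> M" "K \<inter> B = {}"
  shows "weight (insert e M) (K \<union> B) w =
    weight M K w * exp (\<mu> / real Q * ((if w \<in> e then gain (deg M w) else 0) - real (deg B w)))"
proof -
  have "danger (insert e M) (K \<union> B) w =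
      danger M K w + ((if w \<in> e then gain (deg M w) else 0) - real (deg B w))"
    using assms by (simp add: danger_def deg_insert deg_Un_disjoint required_Suc)
  then show ?thesis by (simp add: weight_def distrib_left exp_add)
qed

text \<open>Breaker's edges only lower the danger, and a gain is at most \<open>Q\<close>, so the
  exponent rises by at most \<open>\<mu>\<close>, and only at the ends of \<open>e\<close>.\<close>

lemma weight_growth:
  assumes "finite M" "finite K" "finite B" "e \<notin> M" "K \<inter> B = {}" "real (deg M w) \<le> D"
  shows "weight (insert e M) (K \<union> B) w \<le> weight M K w + (if w \<in> e then 2 * \<mu> * weight M K w else 0)"
proof -
  define t where "t = \<mu> / real Q * ((if w \<in> e then gain (deg M w) else 0) - real (deg B w))"
  have "t \<le> \<mu> / real Q * (if w \<in> e then real Q else 0)"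
    unfolding t_def using gain_bounds(3)[OF assms(6)] \<mu>_bounds by (intro mult_left_mono) auto
  then have t: "t \<le> (if w \<in> e then \<mu> else 0)" using Q by (auto split: if_splits)
  have "exp t \<le> 1 + (if w \<in> e then 2 * \<mu> else 0)"
  proof (cases "w \<in> e")
    case True
    have "exp t \<le> exp \<mu>" using t True by simp
    also have "\<dots> \<le> 1 + \<mu> + \<mu>\<^sup>2" using \<mu>_bounds by (intro exp_le_quadratic) simp
    also have "\<mu>\<^sup>2 \<le> \<mu>" using \<mu>_bounds by (simp add: power2_eq_square mult_le_cancel_right1)
    finally show ?thesis using True by simp
  qed (use t in simp)
  then have "weight M K w * exp t \<le> weight M K w * (1 + (if w \<in> e then 2 * \<mu> else 0))"
    using weight_nonneg by (intro mult_left_mono) auto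
  then show ?thesis
    using weight_update[OF assms(1-5)] by (simp add: t_def algebra_simps split: if_splits)
qed

lemma edge_weight_growth:
  assumes "finite M" "finite K" "finite B" "e \<notin> M" "K \<inter> B = {}" "\<And>w. real (deg M w) \<le> D"
    and "finite e" "finite e'"
  shows "edge_weight (insert e M) (K \<union> B) e' \<le> edge_weight M K e' + 2 * \<mu> * edge_weight M K e"
proof -
  have "edge_weight (insert e M) (K \<union> B) e'
      \<le> (\<Sum>w\<in>e'. weight M K w + (if w \<in> e then 2 * \<mu> * weight M K w else 0))"
    unfolding edge_weight_def by (intro sum_mono weight_growth assms)
  also have "\<dots> = edge_weight M K e' + (\<Sum>w\<in>e' \<inter> e. 2 * \<mu> * weight M K w)"
    using assms(8) by (simp add: sum.distrib edge_weight_def sum.inter_restrict)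
  also have "(\<Sum>w\<in>e' \<inter> e. 2 * \<mu> * weight M K w) \<le> (\<Sum>w\<in>e. 2 * \<mu> * weight M K w)"
    using assms(7) \<mu>_bounds weight_nonneg by (intro sum_mono2) auto
  finally show ?thesis by (simp add: edge_weight_def sum_distrib_left)
qed

section \<open>Effect of a single reply on the potential\<close>

context
  fixes M K U C B :: "nat set set" and u v :: nat
  assumes safe: "safe M K" and uv: "{u, v} \<in> free M K" "u \<noteq> v"
    and U_def: "U = free M K - {{u, v}}" and C_def: "C = closing k {u, v} M U"
    and B: "B \<subseteq> U" "C \<subseteq> B" "card B \<le> Q"
begin

private abbreviation "s \<equiv> weight M K u + weight M K v"

private lemma deg_D: "real (deg M w) \<le> D"
  using safe by (simp add: safe_def)

private lemma fin: "finite M" "finite K" "finite B"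
  using safe B finite_subset[OF _ finite_complete_edges] finite_subset[OF B(1)]
  by (auto simp: safe_def U_def)

private lemma disjoint: "{u, v} \<notin> M" "K \<inter> B = {}"
  using uv B by (auto simp: free_def U_def)

private lemma B_edges: "e \<in> B \<Longrightarrow> e \<in> complete_edges n"
  using B by (auto simp: free_def U_def)

private lemma uv_lt: "u < n" "v < n"
  using uv by (auto simp: free_def complete_edges_def nsets_def)

private lemma edge_weight_uv: "edge_weight M K {u, v} = s"
  using uv(2) by (simp add: edge_weight_def)

lemma potential_bound:
  "(\<Sum>w<n. weight (insert {u, v} M) (K \<union> B) w) \<le> (\<Sum>w<n. weight M K w)
    + \<mu> / real Q * (gain (deg M u) * weight M K u + gain (deg M v) * weight M K v)
    - (1 - \<mu>) * (\<mu> / real Q) * (\<Sum>e\<in>B. edge_weight M K e) + 4 * \<mu>\<^sup>2 * s"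
proof -
  have sub: "e \<subseteq> {..<n}" if "e \<in> B" for e
    using B_edges[OF that] by (auto simp: complete_edges_def nsets_def)
  show ?thesis
    unfolding weight_update[OF fin disjoint] edge_weight_def
    by (rule potential_change[where Q = "real Q"])
      (use uv uv_lt fin sub B(3) weight_nonneg \<mu>_bounds Q gain_bounds(3)[OF deg_D] in auto)
qed

private lemma closing_avoiding:
  "real (card {e \<in> C. u \<notin> e}) \<le> real Q - (gain (deg M u) + \<delta> * real Q)"
  "real (card {e \<in> C. v \<notin> e}) \<le> real Q - (gain (deg M v) + \<delta> * real Q)"
proof -
  have no: "\<not> contains_cycle k (insert {u, v} M)" "\<And>e'. e' \<in> U \<Longrightarrow> \<not> contains_cycle k (insert e' M)"
    using safe uv by (auto simp: safe_def U_def)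
  show "real (card {e \<in> C. u \<notin> e}) \<le> real Q - (gain (deg M u) + \<delta> * real Q)"
    using card_closing_avoiding_le[OF k fin(1) deg_D no]
    by (simp add: C_def gain_def algebra_simps)
  have "\<not> contains_cycle k (insert {v, u} M)" using no(1) by (simp add: insert_commute)
  then show "real (card {e \<in> C. v \<notin> e}) \<le> real Q - (gain (deg M v) + \<delta> * real Q)"
    using card_closing_avoiding_le[OF k fin(1) deg_D _ no(2)]
    by (simp add: C_def gain_def algebra_simps insert_commute[of u v "{}"])
qed

private lemma edge_weight_ge:
  assumes "e \<in> B"
  shows "(if u \<in> e then weight M K u else 0) + (if v \<in> e then weight M K v else 0) \<le> edge_weight M K e"
proof -
  have "finite e" using B_edges[OF assms] by (auto elim: complete_edgesE)
  then have "(\<Sum>w\<in>e \<inter> {u, v}. weight M K w) \<le> edge_weight M K e"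
    unfolding edge_weight_def using weight_nonneg by (intro sum_mono2) auto
  moreover have "(\<Sum>w\<in>e \<inter> {u, v}. weight M K w) = (\<Sum>w\<in>{u, v}. if w \<in> e then weight M K w else 0)"
    using sum.inter_restrict[of "{u, v}" "weight M K" e] by (simp add: Int_commute)
  ultimately show ?thesis using uv(2) by simp
qed

text \<open>Every edge of \<open>B\<close> is credited with the weights of \<open>u\<close> and
  \<open>v\<close>, except that a threat is credited only with the ends it contains. Up to the
  factor \<open>1 - \<delta> / 10\<close>, no edge is credited with more than it weighs, and each
  end is missed only by the threats avoiding it.\<close>

lemma reply_weight_ge:
  assumes full: "card B = Q"
    and heavy: "\<And>e. e \<in> B - C \<Longrightarrow> (1 - \<delta> / 10) * s \<le> edge_weight M K e"
  shows "(1 - \<delta> / 10) * ((gain (deg M u) + \<delta> * real Q) * weight M K u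
      + (gain (deg M v) + \<delta> * real Q) * weight M K v) \<le> (\<Sum>e\<in>B. edge_weight M K e)"
proof -
  let ?f = "\<lambda>x e. if e \<in> C \<and> x \<notin> e then 0 else weight M K x"
  have f_sum: "(gain (deg M x) + \<delta> * real Q) * weight M K x \<le> (\<Sum>e\<in>B. ?f x e)"
    if x: "real (card {e \<in> C. x \<notin> e}) \<le> real Q - (gain (deg M x) + \<delta> * real Q)" for x
  proof -
    have "(\<Sum>e\<in>B. ?f x e) = (\<Sum>e\<in>B - {e \<in> C. x \<notin> e}. weight M K x)"
      using fin(3) by (intro sum.mono_neutral_cong_right) auto
    also have "\<dots> = real (card (B - {e \<in> C. x \<notin> e})) * weight M K x" by simp
    also have "card (B - {e \<in> C. x \<notin> e}) = card B - card {e \<in> C. x \<notin> e}"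
      using B(2) fin(3) by (intro card_Diff_subset) (auto intro: finite_subset)
    also have "real (card B - card {e \<in> C. x \<notin> e}) = real Q - real (card {e \<in> C. x \<notin> e})"
      using full B(2) fin(3) card_mono[of B "{e \<in> C. x \<notin> e}"] by (subst of_nat_diff) auto
    finally have "(\<Sum>e\<in>B. ?f x e) = (real Q - real (card {e \<in> C. x \<notin> e})) * weight M K x" .
    then show ?thesis using x weight_pos[of M K x] by (auto intro!: mult_right_mono)
  qed
  have "(1 - \<delta> / 10) * ((gain (deg M u) + \<delta> * real Q) * weight M K u
      + (gain (deg M v) + \<delta> * real Q) * weight M K v)
    \<le> (1 - \<delta> / 10) * ((\<Sum>e\<in>B. ?f u e) + (\<Sum>e\<in>B. ?f v e))"
    using f_sum[OF closing_avoiding(1)] f_sum[OF closing_avoiding(2)] \<delta>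
    by (intro mult_left_mono add_mono) auto
  also have "\<dots> = (\<Sum>e\<in>B. (1 - \<delta> / 10) * (?f u e + ?f v e))"
    by (simp only: sum.distrib[symmetric] sum_distrib_left)
  also have "\<dots> \<le> (\<Sum>e\<in>B. edge_weight M K e)"
  proof (rule sum_mono)
    fix e assume e: "e \<in> B"
    show "(1 - \<delta> / 10) * (?f u e + ?f v e) \<le> edge_weight M K e"
    proof (cases "e \<in> C")
      case True
      have "0 \<le> ?f u e + ?f v e" using weight_pos[of M K] by (simp add: less_imp_le)
      then have "(1 - \<delta> / 10) * (?f u e + ?f v e) \<le> ?f u e + ?f v e"
        using \<delta> by (simp add: mult_left_le_one_le)
      also have "\<dots> \<le> edge_weight M K e" using edge_weight_ge[OF e] True by (auto split: if_splits)
      finally show ?thesis .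
    next
      case False
      then show ?thesis using heavy[of e] e by simp
    qed
  qed
  finally show ?thesis .
qed

lemma potential_decreases:
  assumes "card B = Q" "\<And>e. e \<in> B - C \<Longrightarrow> (1 - \<delta> / 10) * s \<le> edge_weight M K e"
  shows "(\<Sum>w<n. weight (insert {u, v} M) (K \<union> B) w) \<le> (\<Sum>w<n. weight M K w) - \<mu> * \<delta> / 2 * s"
proof -
  define \<theta> where "\<theta> = (1 - \<mu>) * (1 - \<delta> / 10)"
  have \<theta>: "1 - \<theta> \<le> \<mu> + \<delta> / 10" "\<theta> \<le> 1"
    using \<mu>_bounds \<delta> by (auto simp: \<theta>_def algebra_simps mult_le_one)
  define r where "r = \<mu> / real Q"
  have r: "0 \<le> r" "r * real Q = \<mu>" using \<mu>_bounds Q by (auto simp: r_def)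
  \<comment> \<open>The two ends are treated separately: at each, the slack
    \<open>\<delta> * Q\<close> outweighs the losses of order \<open>\<mu> * Q\<close> and
    \<open>\<delta> / 10 * Q\<close>.\<close>
  have part: "r * (gain (deg M x) - \<theta> * (gain (deg M x) + \<delta> * real Q)) + 4 * \<mu>\<^sup>2 \<le> - (\<mu> * \<delta> / 2)" for x
  proof -
    define y where "y = gain (deg M x) + \<delta> * real Q"
    have y: "0 \<le> y" "y \<le> real Q" using gain_bounds[OF deg_D[of x]] by (auto simp: y_def)
    have "gain (deg M x) - \<theta> * y = y * (1 - \<theta>) - \<delta> * real Q" by (simp add: y_def algebra_simps)
    also have "\<dots> \<le> real Q * (\<mu> + \<delta> / 10) - \<delta> * real Q"
      using y \<theta> by (intro diff_right_mono mult_mono) auto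
    finally have "r * (gain (deg M x) - \<theta> * y) \<le> r * (real Q * (\<mu> + \<delta> / 10) - \<delta> * real Q)"
      using r by (intro mult_left_mono) auto
    also have "\<dots> = (r * real Q) * (\<mu> + \<delta> / 10 - \<delta>)" by (simp add: algebra_simps)
    finally have "r * (gain (deg M x) - \<theta> * y) + 4 * \<mu>\<^sup>2 \<le> \<mu> * (5 * \<mu> + \<delta> / 10 - \<delta>)"
      by (simp add: r algebra_simps power2_eq_square)
    also have "\<dots> \<le> \<mu> * (- (\<delta> / 2))" using \<mu>_bounds \<delta> by (intro mult_left_mono) auto
    finally show ?thesis by (simp add: y_def)
  qed
  let ?W = "\<Sum>e\<in>B. edge_weight M K e"
  let ?y = "\<lambda>x. gain (deg M x) + \<delta> * real Q"
  have "(1 - \<mu>) * (r) * ((1 - \<delta> / 10) * (?y u * weight M K u + ?y v * weight M K v))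
     \<le> (1 - \<mu>) * (r) * ?W"
    using reply_weight_ge[OF assms] \<mu>_bounds r by (intro mult_left_mono) auto
  also have "(1 - \<mu>) * (r) * ((1 - \<delta> / 10) * (?y u * weight M K u + ?y v * weight M K v))
     = r * (\<theta> * ?y u) * weight M K u + r * (\<theta> * ?y v) * weight M K v"
    by (simp add: \<theta>_def algebra_simps)
  finally have "(\<Sum>w<n. weight (insert {u, v} M) (K \<union> B) w) \<le> (\<Sum>w<n. weight M K w)
     + (r * (gain (deg M u) - \<theta> * ?y u) + 4 * \<mu>\<^sup>2) * weight M K u
     + (r * (gain (deg M v) - \<theta> * ?y v) + 4 * \<mu>\<^sup>2) * weight M K v"
    using potential_bound[folded r_def] by (simp add: algebra_simps)
  also have "\<dots> \<le> (\<Sum>w<n. weight M K w) + (- (\<mu> * \<delta> / 2)) * weight M K u + (- (\<mu> * \<delta> / 2)) * weight M K v"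
    using part weight_nonneg by (intro add_mono mult_right_mono order_refl) blast+
  finally show ?thesis by (simp add: algebra_simps)
qed

text \<open>A crude bound for the case where Breaker runs out of heavy edges; it ignores what the
  reply gains.\<close>

lemma potential_increase:
  "(\<Sum>w<n. weight (insert {u, v} M) (K \<union> B) w) \<le> (\<Sum>w<n. weight M K w) + 2 * \<mu> * s"
proof -
  have "(\<Sum>w<n. weight (insert {u, v} M) (K \<union> B) w)
      \<le> (\<Sum>w<n. weight M K w + (if w \<in> {u, v} then 2 * \<mu> * weight M K w else 0))"
    by (intro sum_mono weight_growth fin disjoint deg_D)
  also have "\<dots> = (\<Sum>w<n. weight M K w) + (\<Sum>w\<in>{..<n} \<inter> {u, v}. 2 * \<mu> * weight M K w)"
    by (simp only: sum.distrib sum.inter_restrict[OF finite_lessThan])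
  also have "{..<n} \<inter> {u, v} = {u, v}" using uv_lt by auto
  also have "(\<Sum>w\<in>{u, v}. 2 * \<mu> * weight M K w) = 2 * \<mu> * s"
    using uv(2) by (simp add: algebra_simps)
  finally show ?thesis .
qed

lemma controlled_after_reply:
  assumes dichotomy: "{e \<in> U - C. (1 - \<delta> / 10) * s \<le> edge_weight M K e} \<subseteq> B \<or>
    card B = Q \<and> B - C \<subseteq> {e \<in> U - C. (1 - \<delta> / 10) * s \<le> edge_weight M K e}"
  shows "controlled (insert {u, v} M) (K \<union> B)"
proof -
  obtain T where T: "0 \<le> T" "\<And>e. e \<in> free M K \<Longrightarrow> edge_weight M K e \<le> T"
    "(\<Sum>w<n. weight M K w) + \<delta> / 4 * T \<le> 2 * real n"
    using safe by (auto simp: safe_def controlled_def)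
  have s: "0 < s" using weight_pos[of M K] by (simp add: add_pos_pos)
  have sT: "s \<le> T" using T(2)[OF uv(1)] by (simp add: edge_weight_uv)
  have free: "e \<in> U - B" if "e \<in> free (insert {u, v} M) (K \<union> B)" for e
    using that by (auto simp: free_def U_def)
  have growth: "edge_weight (insert {u, v} M) (K \<union> B) e \<le> edge_weight M K e + 2 * \<mu> * s"
    if "e \<in> U - B" for e
  proof -
    have "finite e" using that by (auto simp: U_def free_def elim: complete_edgesE)
    then show ?thesis
      using edge_weight_growth[OF fin disjoint deg_D, of e] by (simp add: edge_weight_uv)
  qed
  from dichotomy show ?thesis
  proof
    \<comment> \<open>Every remaining free edge was light, so \<open>T\<close> falls from at least
      \<open>s\<close> to \<open>(1 - \<delta> / 10 + 2 * \<mu>) * s\<close>. By the choice of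
      \<open>\<mu>\<close>, \<open>\<delta> / 4 * (\<delta> / 10)\<close> is
      \<open>5 * \<mu>\<close>, which pays for the growth \<open>2 * \<mu> * s\<close> of the total
      weight.\<close>
    assume heavy: "{e \<in> U - C. (1 - \<delta> / 10) * s \<le> edge_weight M K e} \<subseteq> B"
    have "edge_weight (insert {u, v} M) (K \<union> B) e \<le> (1 - \<delta> / 10 + 2 * \<mu>) * s"
      if "e \<in> free (insert {u, v} M) (K \<union> B)" for e
    proof -
      have "edge_weight M K e < (1 - \<delta> / 10) * s" using free[OF that] heavy B(2) by auto
      then show ?thesis using growth[OF free[OF that]] by (simp add: algebra_simps)
    qed
    moreover have "0 \<le> (1 - \<delta> / 10 + 2 * \<mu>) * s"
      using \<delta> \<mu>_bounds s by (intro mult_nonneg_nonneg) auto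
    moreover have "(\<Sum>w<n. weight (insert {u, v} M) (K \<union> B) w)
        + \<delta> / 4 * ((1 - \<delta> / 10 + 2 * \<mu>) * s) \<le> 2 * real n"
    proof -
      have "\<delta> * \<mu> \<le> 1 * \<mu>" using \<delta> \<mu>_bounds by (intro mult_right_mono) auto
      moreover have "2 * \<mu> + \<delta> / 4 * (- (\<delta> / 10) + 2 * \<mu>) = 2 * \<mu> - 5 * \<mu> + \<delta> * \<mu> / 2"
        by (simp add: \<mu>_def power2_eq_square algebra_simps)
      ultimately have "2 * \<mu> + \<delta> / 4 * (- (\<delta> / 10) + 2 * \<mu>) \<le> 0"
        using \<mu>_bounds(1) by linarith
      then have "(2 * \<mu> + \<delta> / 4 * (- (\<delta> / 10) + 2 * \<mu>)) * s \<le> 0"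
        using s by (simp add: mult_le_0_iff)
      moreover have "\<delta> / 4 * s \<le> \<delta> / 4 * T" using sT \<delta> by (intro mult_left_mono) auto
      ultimately show ?thesis using potential_increase T(3) by (simp add: algebra_simps)
    qed
    ultimately show ?thesis unfolding controlled_def by blast
  next
    \<comment> \<open>\<open>T\<close> is raised by \<open>2 * \<mu> * s\<close>; its coefficient
      \<open>\<delta> / 4\<close> makes this cost \<open>\<mu> * \<delta> / 2 * s\<close>, exactly
      the drop of the total weight.\<close>
    assume full: "card B = Q \<and> B - C \<subseteq> {e \<in> U - C. (1 - \<delta> / 10) * s \<le> edge_weight M K e}"
    have "edge_weight (insert {u, v} M) (K \<union> B) e \<le> T + 2 * \<mu> * s"
      if "e \<in> free (insert {u, v} M) (K \<union> B)" for e
      using growth[OF free[OF that]] T(2)[of e] free[OF that] by (auto simp: U_def)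
    moreover have "0 \<le> T + 2 * \<mu> * s" using T(1) \<mu>_bounds s by simp
    moreover have "(\<Sum>w<n. weight (insert {u, v} M) (K \<union> B) w) + \<delta> / 4 * (T + 2 * \<mu> * s) \<le> 2 * real n"
      using potential_decreases full T(3) by (fastforce simp: algebra_simps)
    ultimately show ?thesis unfolding controlled_def by blast
  qed
qed

end

text \<open>All threats are claimed first, so none is left for Maker; the rest of the reply goes to
  edges nearly as heavy as Maker's, with weights measured before the round.\<close>

lemma safe_reply:
  assumes safe: "safe M K" and e: "e \<in> free M K"
  obtains B where "B \<subseteq> free M K - {e}" "card B \<le> Q" "free M K - {e} \<noteq> {} \<longrightarrow> B \<noteq> {}"
    "safe (insert e M) (K \<union> B)"
proof -
  obtain u v where uv: "e = {u, v}" "u \<noteq> v"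
    using e by (auto simp: free_def elim: complete_edgesE)
  define s where "s = weight M K u + weight M K v"
  define U where "U = free M K - {{u, v}}"
  define C where "C = closing k {u, v} M U"
  define H where "H = {e \<in> U - C. (1 - \<delta> / 10) * s \<le> edge_weight M K e}"
  have M: "finite M" using safe finite_subset[OF _ finite_complete_edges] by (auto simp: safe_def)
  have "real (card C) \<le> (real k - 1) * D ^ (k - 2)"
    unfolding C_def using safe e uv by (intro card_closing_le k M) (auto simp: safe_def U_def)
  then have "card C \<le> Q" using closing_bound by linarith
  then obtain B where B: "B \<subseteq> U" "C \<subseteq> B" "card B \<le> Q" "U \<noteq> {} \<longrightarrow> B \<noteq> {}"
    "H \<subseteq> B \<or> card B = Q \<and> B - C \<subseteq> H"
    using edge_set_choice[of U C H Q] Q by (auto simp: U_def C_def H_def closing_def)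
  have "controlled (insert {u, v} M) (K \<union> B)"
    by (rule controlled_after_reply[OF safe _ uv(2) U_def C_def B(1-3)])
      (use e uv B(5) in \<open>auto simp: H_def s_def\<close>)
  moreover have "real (deg (insert e M) w) \<le> D" for w
    using deg_le_of_safe[OF safe, of w] e M by (simp add: deg_insert free_def)
  moreover have "\<not> contains_cycle k (insert e' (insert e M))"
    if "e' \<in> free (insert e M) (K \<union> B)" for e'
    using that B(2) uv by (auto simp: C_def closing_def U_def free_def)
  ultimately have "safe (insert e M) (K \<union> B)"
    using safe e B(1) uv by (auto simp: safe_def free_def U_def)
  then show ?thesis using B uv by (intro that[of B]) (auto simp: U_def)
qed

section \<open>The initial position and the winning strategy\<close>

lemma not_contains_cycle_singleton: "\<not> contains_cycle k {e}"
proof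
  assume "contains_cycle k {e}"
  then obtain f where f: "inj_on f {..<k}" "\<forall>i<k. {f i, f ((i + 1) mod k)} \<in> {e}"
    by (auto simp: contains_cycle_iff)
  \<comment> \<open>Two consecutive edges of a cycle of length at least 3 differ, so one edge cannot
    serve as both.\<close>
  have "{f 0, f 1} = {f 1, f 2}" using f(2)[rule_format, of 0] f(2)[rule_format, of 1] k by (simp add: numeral_2_eq_2)
  then have "f 0 = f 1 \<or> f 0 = f 2" by (auto simp: doubleton_eq_iff)
  then show False using inj_onD[OF f(1), of 0 1] inj_onD[OF f(1), of 0 2] k by auto
qed

lemma safe_initial: "safe {} {}"
proof -
  have w: "weight {} {} w = 1" for w by (simp add: weight_def danger_def required_def)
  have "edge_weight {} {} e = 2" if "e \<in> free {} {}" for e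
    using that by (auto simp: free_def edge_weight_def w elim!: complete_edgesE)
  \<comment> \<open>Initially all weights are 1 and each edge weighs 2; with \<open>T = 2\<close>
    the extra term is \<open>\<delta> / 2\<close>.\<close>
  moreover have "\<delta> / 2 \<le> real n" using \<delta> n by (cases n) auto
  ultimately have "controlled {} {}"
    unfolding controlled_def by (intro exI[of _ 2]) (simp add: w)
  moreover have "0 < k" using k by simp
  then have "\<not> contains_cycle k {}" by (auto simp: contains_cycle_iff)
  ultimately show ?thesis using D not_contains_cycle_singleton by (simp add: safe_def)
qed

lemma breaker_wins:
  assumes "\<lfloor>q\<rfloor> = int Q"
  shows "breaker_has_winning_strategy k n q"
proof (rule winning_strategy_from_invariant[where I = "\<lambda>h. safe (maker_edges h) (breaker_edges h)"])
  show "\<lfloor>q\<rfloor> \<ge> 1" using assms Q by simp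
  show "safe (maker_edges []) (breaker_edges [])"
    using safe_initial by (simp add: maker_edges_def breaker_edges_def)
  show "\<not> contains_cycle k (maker_edges h)" if "safe (maker_edges h) (breaker_edges h)" for h
    using that by (simp add: safe_def)
  fix h e
  assume h: "safe (maker_edges h) (breaker_edges h)" and e: "e \<in> unclaimed n h"
  have eq: "unclaimed n h = free (maker_edges h) (breaker_edges h)"
    by (simp add: unclaimed_def free_def)
  obtain B where "B \<subseteq> unclaimed n h - {e}" "card B \<le> Q" "unclaimed n h - {e} \<noteq> {} \<longrightarrow> B \<noteq> {}"
    "safe (insert e (maker_edges h)) (breaker_edges h \<union> B)"
    using safe_reply[OF h] e unfolding eq by metis
  then show "\<exists>B. legal_reply n q h e B \<and>
      safe (maker_edges (h @ [(e, B)])) (breaker_edges (h @ [(e, B)]))"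
    using assms by (auto simp: legal_reply_def intro!: exI[of _ B])
qed

end

section \<open>Choice of the parameters\<close>

lemma root_at_top:
  assumes "0 < m"
  shows "filterlim (root m) at_top at_top"
  by (rule filterlim_at_top_at_top[where Q = "\<lambda>x. True" and P = "\<lambda>x. 0 < x" and g = "\<lambda>x. x ^ m"])
    (use assms in \<open>auto simp: real_root_power_cancel intro: eventually_gt_at_top\<close>)

text \<open>The origin of the bias: if Maker's degrees are at most \<open>\<beta> * x / q\<close>,
  the bound on the number of threats is exactly \<open>q\<close>.\<close>

lemma bias_equation:
  fixes k :: nat and \<beta> x q :: real
  assumes k: "k \<ge> 3" and pos: "0 < \<beta>" "0 < x"
    and q: "q = root (k - 1) ((real k - 1) * \<beta> ^ (k - 2) * x ^ (k - 2))"
  shows "0 < q" "(real k - 1) * (\<beta> * x / q) ^ (k - 2) = q"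
proof -
  have p: "0 < (real k - 1) * \<beta> ^ (k - 2) * x ^ (k - 2)" using k pos by simp
  show q0: "0 < q" using q p k by simp
  have "q * q ^ (k - 2) = q ^ (k - 1)" using k by (simp flip: power_Suc add: Suc_diff_Suc numeral_2_eq_2)
  also have "\<dots> = (real k - 1) * \<beta> ^ (k - 2) * x ^ (k - 2)"
    unfolding q using k p by (intro real_root_pow_pos2) auto
  finally show "(real k - 1) * (\<beta> * x / q) ^ (k - 2) = q"
    using q0 by (simp add: power_divide power_mult_distrib field_simps)
qed

text \<open>The bias is a constant times \<open>n powr p\<close> with \<open>p < 1\<close>, so even
  with a logarithmic factor it is \<open>o(n)\<close>.\<close>

lemma root_bias_sublinear:
  fixes k :: nat and \<beta> a b :: real
  assumes "k \<ge> 3"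
  shows "(\<lambda>n. root (k - 1) ((real k - 1) * \<beta> ^ (k - 2) * real n ^ (k - 2)) * (a + ln (2 * real n) * b) / real n)
    \<longlonglongrightarrow> 0"
proof -
  define p where "p = real (k - 2) / real (k - 1)"
  define c where "c = root (k - 1) ((real k - 1) * \<beta> ^ (k - 2))"
  have p: "p < 1" using assms by (simp add: p_def field_simps)
  have "(\<lambda>n. c * real n powr p * (a + ln (2 * real n) * b) / real n) \<longlonglongrightarrow> 0"
    using p by real_asymp
  moreover have "\<forall>\<^sub>F n in sequentially. c * real n powr p * (a + ln (2 * real n) * b) / real n =
    root (k - 1) ((real k - 1) * \<beta> ^ (k - 2) * real n ^ (k - 2)) * (a + ln (2 * real n) * b) / real n"
    using eventually_gt_at_top[of 0]
  proof eventually_elim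
    case (elim n)
    have "root (k - 1) (real n ^ (k - 2)) = real n powr p"
      using elim assms by (simp add: root_powr_inverse p_def powr_powr flip: powr_realpow)
    then show ?case by (simp add: real_root_mult c_def)
  qed
  ultimately show ?thesis by (rule Lim_transform_eventually)
qed

theorem theorem3p1:
  fixes k :: nat and \<beta> :: real and q :: "nat \<Rightarrow> real"
  assumes "k \<ge> 3"
    and "\<beta> > 2 * (real k - 1) / real k"
    and "\<And>n. q n = root (k - 1) ((real k - 1) * \<beta> ^ (k - 2) * real n ^ (k - 2))"
  shows "\<exists>N::nat. \<forall>n>N. breaker_has_winning_strategy k n (q n)"
proof -
  define \<kappa> where "\<kappa> = real k / (2 * (real k - 1))"
  have \<kappa>: "0 < \<kappa>" "\<kappa> \<le> 1" using assms(1) by (auto simp: \<kappa>_def field_simps)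
  have "0 < 2 * (real k - 1) / real k" using assms(1) by simp
  then have \<beta>: "0 < \<beta>" using assms(2) by linarith
  \<comment> \<open>Strictness leaves room for \<open>\<delta>\<close>: one factor
    \<open>1 - \<delta>\<close> pays for shrinking \<open>D\<close>, one for rounding
    \<open>q n\<close> down, and \<open>\<kappa> - \<delta>\<close> for the slack in
    \<open>gain\<close>.\<close>
  have "1 < \<beta> * \<kappa>" using assms(1,2) by (simp add: \<kappa>_def field_simps)
  moreover have "((\<lambda>\<delta>. (1 - \<delta>)\<^sup>2 * \<beta> * (\<kappa> - \<delta>)) \<longlongrightarrow> (1 - 0)\<^sup>2 * \<beta> * (\<kappa> - 0)) (at_right 0)"
    by (intro tendsto_intros)
  ultimately have "\<forall>\<^sub>F \<delta> in at_right 0. 1 < (1 - \<delta>)\<^sup>2 * \<beta> * (\<kappa> - \<delta>)"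
    by (intro order_tendstoD(1)) auto
  moreover have "\<forall>\<^sub>F \<delta> in at_right 0. 0 < \<delta> \<and> \<delta> < \<kappa>"
    using \<kappa>(1) by (auto simp: eventually_at_right_field)
  ultimately have "\<forall>\<^sub>F \<delta> in at_right (0::real). 1 < (1 - \<delta>)\<^sup>2 * \<beta> * (\<kappa> - \<delta>) \<and> 0 < \<delta> \<and> \<delta> < \<kappa>"
    by eventually_elim simp
  then obtain \<delta> where \<delta>: "1 < (1 - \<delta>)\<^sup>2 * \<beta> * (\<kappa> - \<delta>)" "0 < \<delta>" "\<delta> < \<kappa>"
    using eventually_happens'[OF trivial_limit_at_right_real] by blast
  have \<delta>1: "\<delta> \<le> 1" using \<delta>(3) \<kappa>(2) by linarith
  define \<mu> where "\<mu> = \<delta>\<^sup>2 / 200"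
  have \<mu>: "0 < \<mu>" using \<delta> by (simp add: \<mu>_def)
  \<comment> \<open>The first entry absorbs the lower-order terms of \<open>degree_bound\<close>,
    the second ensures \<open>1 \<le> D\<close>.\<close>
  define \<epsilon> where "\<epsilon> = min ((1 - \<delta>)\<^sup>2 * \<beta> * (\<kappa> - \<delta>) - 1) ((1 - \<delta>) * \<beta>)"
  have \<epsilon>: "0 < \<epsilon>" using \<delta> \<kappa> \<beta> by (simp add: \<epsilon>_def)
  have large: "\<forall>\<^sub>F n in sequentially. breaker_has_winning_strategy k n (q n)"
  proof -
    have "filterlim q at_top sequentially"
    proof -
      have "filterlim (\<lambda>n. (real k - 1) * \<beta> ^ (k - 2) * real n ^ (k - 2)) at_top sequentially"
        using assms(1) \<beta>
        by (intro filterlim_tendsto_pos_mult_at_top[OF tendsto_const] filterlim_pow_at_top filterlim_real_sequentially) auto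
      then show ?thesis
        unfolding assms(3)[abs_def] using assms(1)
        by (intro filterlim_compose[OF root_at_top]) auto
    qed
    \<comment> \<open>The first bound makes rounding cost at most the factor
      \<open>1 - \<delta>\<close>, the second makes \<open>Q\<close> positive.\<close>
    then have "\<forall>\<^sub>F n in sequentially. 1 / \<delta> \<le> q n" "\<forall>\<^sub>F n in sequentially. 2 \<le> q n"
      by (auto simp: filterlim_at_top)
    moreover have "\<forall>\<^sub>F n in sequentially. q n * ((1 + (\<kappa> - \<delta>)) + ln (2 * real n) * (1 / \<mu>)) / real n < \<epsilon>"
      unfolding assms(3) by (rule order_tendstoD(2)[OF root_bias_sublinear[OF assms(1)] \<epsilon>])
    ultimately show ?thesis
      using eventually_gt_at_top[of 0]
    proof eventually_elim
      case (elim n)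
      \<comment> \<open>Shrinking by \<open>1 - \<delta>\<close> cuts the threat bound from
        \<open>q n\<close> to at most \<open>(1 - \<delta>) * q n\<close>, which is at most
        \<open>Q\<close>.\<close>
      define D where "D = (1 - \<delta>) * (\<beta> * real n / q n)"
      define Q where "Q = nat \<lfloor>q n\<rfloor>"
      have q: "0 < q n" "(real k - 1) * (\<beta> * real n / q n) ^ (k - 2) = q n"
        using bias_equation[OF assms(1) \<beta> _ assms(3)] elim by auto
      have Q: "q n - 1 \<le> real Q" "real Q \<le> q n" "0 < Q" and floor_eq: "\<lfloor>q n\<rfloor> = int Q"
        using elim(2) unfolding Q_def by linarith+
      have \<delta>q: "(1 - \<delta>) * q n \<le> real Q"
        using elim(1) \<delta>(2) Q(1) by (simp add: field_simps)
      have small: "q n * ((1 + (\<kappa> - \<delta>)) + ln (2 * real n) * (1 / \<mu>)) < \<epsilon> * real n"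
        using elim by (simp add: field_simps)
      have ln: "0 \<le> ln (2 * real n) * (1 / \<mu>)" using elim \<mu> by simp
      have "q n * 1 \<le> q n * ((1 + (\<kappa> - \<delta>)) + ln (2 * real n) * (1 / \<mu>))"
        using q \<delta> ln by (intro mult_left_mono) linarith+
      also note small
      also have "\<epsilon> * real n \<le> (1 - \<delta>) * \<beta> * real n" by (intro mult_right_mono) (auto simp: \<epsilon>_def)
      finally have D1: "1 \<le> D" using q by (simp add: D_def field_simps)
      have "(1 - \<delta>) ^ (k - 2) \<le> (1 - \<delta>) ^ 1"
        using \<delta> \<kappa> assms(1) by (intro power_decreasing) auto
      then have "(1 - \<delta>) ^ (k - 2) * q n \<le> (1 - \<delta>) ^ 1 * q n"
        using q(1) by (intro mult_right_mono) auto
      then have "(1 - \<delta>) ^ (k - 2) * q n \<le> real Q" using \<delta>q by simp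
      moreover have "(real k - 1) * D ^ (k - 2)
          = (1 - \<delta>) ^ (k - 2) * ((real k - 1) * (\<beta> * real n / q n) ^ (k - 2))"
        unfolding D_def power_mult_distrib[of "1 - \<delta>"] by (rule mult.left_commute)
      ultimately have closing: "(real k - 1) * D ^ (k - 2) \<le> real Q" using q(2) by simp
      have "(1 - \<delta>)\<^sup>2 * \<beta> * real n = D * ((1 - \<delta>) * q n)"
        using q(1) by (simp add: D_def power2_eq_square)
      also have "\<dots> \<le> D * real Q" using \<delta>q D1 by (intro mult_left_mono) auto
      finally have "(1 - \<delta>)\<^sup>2 * \<beta> * real n * (\<kappa> - \<delta>) \<le> D * real Q * (\<kappa> - \<delta>)"
        using \<delta> by (intro mult_right_mono) auto
      moreover have "\<epsilon> * real n \<le> ((1 - \<delta>)\<^sup>2 * \<beta> * (\<kappa> - \<delta>) - 1) * real n"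
        by (intro mult_right_mono) (auto simp: \<epsilon>_def)
      \<comment> \<open>The loss from replacing \<open>D\<close> by \<open>D - 1\<close> and the
        logarithmic term are together below \<open>\<epsilon> * n\<close>.\<close>
      moreover have "real Q * ((\<kappa> - \<delta>) + ln (2 * real n) * (1 / \<mu>))
          \<le> q n * ((1 + (\<kappa> - \<delta>)) + ln (2 * real n) * (1 / \<mu>))"
        using Q q \<delta> ln by (intro mult_mono) linarith+
      ultimately have "real n + real Q * ln (2 * real n) / \<mu> < (D - 1) * real Q * (\<kappa> - \<delta>)"
        using small by (simp add: algebra_simps)
      then interpret cycle_game k n Q D \<delta> \<mu>
        using assms(1) elim(4) Q(3) D1 \<delta>(2) \<delta>1 closing
        by unfold_locales (simp_all add: \<mu>_def \<kappa>_def)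
      show ?case by (rule breaker_wins) (rule floor_eq)
    qed
  qed
  then obtain N where "\<forall>n\<ge>N. breaker_has_winning_strategy k n (q n)"
    by (auto simp: eventually_sequentially)
  then show ?thesis by (intro exI[of _ N]) auto
qed

end
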